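(* Let $u\in(0,1)$ and $\mathscr{C}_n^u:=F^{-(n-1)}[u,1]$ for $n\ge1$. Then \[\sum_{k=0}^n\lambda(\mathscr{C}_{k+1}^u)=\frac{n\log(1/u)}{\log n}\left(1+O_u\!\left(\frac{1}{\log n}\right)\right)\qquad(n\to\infty).\]
   Context: $\lambda$ denotes Lebesgue measure on $[0,1]$. $F:[0,1]\to[0,1]$ is the Farey map, $F(x)=x/(1-x)$ for $0\le x\le 1/2$ and $F(x)=(1-x)/x$ for $1/2<x\le 1$; $F^{-k}$ denotes preimage under the $k$-th iterate. The implied constant depends only on $u$. *)

theory Defs
  imports "HOL-Analysis.Analysis" "HOL-Library.Landau_Symbols"
begin

definition farey :: "real \<Rightarrow> real" where
  "farey x = (if x \<le> 1/2 then x / (1 - x) else (1 - x) / x)"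

definition farey_C :: "real \<Rightarrow> nat \<Rightarrow> real set" where
  "farey_C u n = {x \<in> {0..1}. (farey ^^ (n - 1)) x \<in> {u..1}}"

end

theory Submission
  imports Defs "HOL-Real_Asymp.Real_Asymp"
begin

text \<open>Let \<open>\<Phi>\<^sub>k\<close> be the distribution function of \<open>F\<^sup>k\<close> under Lebesgue measure and \<open>g\<^sub>k\<close> its density with
  respect to the invariant measure \<open>dx / x\<close>. The transfer operator preserves the cone of nonnegative,
  increasing, concave functions, so every \<open>g\<^sub>k\<close> is increasing. Put \<open>b\<^sub>k = g\<^sub>k(1)\<close>; then
  \<open>g\<^sub>k(1/2) = b\<^sub>k\<^sub>+\<^sub>1\<close>, so \<open>b\<^sub>k\<close> decreases and the sum over \<open>k\<close> of \<open>g\<^sub>k(1) - g\<^sub>k(1/2)\<close> telescopes. Through the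
  transfer operator this propagates to a bound on the sum of \<open>g\<^sub>k(1) - g\<^sub>k(x)\<close> for every fixed \<open>x > 0\<close>,
  whence the sum of the measures is \<open>log (1/u) \<Sum> b\<^sub>k + O(1)\<close>.

  Iterating \<open>F\<^sup>-\<^sup>1[0, 1/m] = [0, 1/(m+1)] \<union> [m/(m+1), 1]\<close> yields a renewal identity which, summed over
  time, gives \<open>\<Sum>\<^sub>k\<^sub><\<^sub>n b\<^sub>k log (n+1-k) \<ge> n - log (n+1)\<close> and \<open>\<Sum>\<^sub>k\<^sub><\<^sub>n b\<^sub>k\<^sub>+\<^sub>1 log (n+1-k) \<le> n\<close>. In the first the
  logarithm is at most \<open>log (n+1)\<close>; in the second both factors decrease in \<open>k\<close>, so Chebyshev's sum
  inequality replaces the logarithm by its mean. Together they give \<open>\<Sum>\<^sub>k\<^sub>\<le>\<^sub>n b\<^sub>k = n / log n + O(n / log\<^sup>2 n)\<close>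
  without a Tauberian theorem.\<close>

section \<open>Distribution functions and densities of the iterates\<close>

primrec farey_cdf :: "nat \<Rightarrow> real \<Rightarrow> real" where
  "farey_cdf 0 y = y"
| "farey_cdf (Suc k) y = farey_cdf k (y / (1 + y)) + 1 - farey_cdf k (1 / (1 + y))"

text \<open>The density is taken with respect to \<open>dx / x\<close>, not Lebesgue measure.\<close>

primrec farey_dens :: "nat \<Rightarrow> real \<Rightarrow> real" where
  "farey_dens 0 x = x"
| "farey_dens (Suc k) x = (farey_dens k (x / (1 + x)) + x * farey_dens k (1 / (1 + x))) / (1 + x)"

lemma farey_cdf_1 [simp]: "farey_cdf k 1 = 1"
  by (induction k) auto

text \<open>The inverse branches are \<open>y / (1 + y)\<close> and \<open>1 / (1 + y)\<close>.
  Their images share only the point 1/2, reached when \<open>b = 1\<close>; it then lies in both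
  intervals.\<close>

lemma farey_vimage_Icc:
  assumes "0 \<le> a" "a \<le> b" "b \<le> 1" "0 \<le> x" "x \<le> 1"
  shows "farey x \<in> {a..b} \<longleftrightarrow> x \<in> {a / (1 + a)..b / (1 + b)} \<union> {1 / (1 + b)..1 / (1 + a)}"
proof (cases "x \<le> 1 / 2")
  case True
  have 1: "farey x \<in> {a..b} \<longleftrightarrow> x \<in> {a / (1 + a)..b / (1 + b)}"
    using assms True by (auto simp: farey_def field_simps)
  have "x \<in> {a / (1 + a)..b / (1 + b)}" if "1 / (1 + b) \<le> x"
  proof -
    have "1 / 2 \<le> 1 / (1 + b)" and half: "a / (1 + a) \<le> 1 / 2"
      using assms by (auto simp: field_simps)
    then have "x = 1 / 2" and "1 / (1 + b) = 1 / 2"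
      using that True by linarith+
    moreover from this(2) have "b = 1"
      using assms by (simp add: field_simps)
    ultimately show ?thesis
      unfolding atLeastAtMost_iff using half by (simp only:) simp
  qed
  then show ?thesis
    using 1 by auto
next
  case False
  have 1: "farey x \<in> {a..b} \<longleftrightarrow> x \<in> {1 / (1 + b)..1 / (1 + a)}"
    using assms False by (auto simp: farey_def field_simps)
  have "b / (1 + b) \<le> 1 / 2"
    using assms by (simp add: field_simps)
  then have "\<not> x \<le> b / (1 + b)"
    using False by linarith
  then show ?thesis
    using 1 by auto
qed

lemma farey_in_unit:
  assumes "x \<in> {0..1}"
  shows "farey x \<in> {0..1}"
  using assms by (auto simp: farey_def field_simps)

lemma farey_funpow_in_unit:
  assumes "x \<in> {0..1}"
  shows "(farey ^^ k) x \<in> {0..1}"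
  using assms farey_in_unit by (induction k) auto

lemma farey_measurable [measurable]: "farey \<in> borel_measurable borel"
  unfolding farey_def by measurable

lemma farey_funpow_measurable [measurable]: "(farey ^^ k) \<in> borel_measurable borel"
  by (induction k) auto

lemma farey_preimage_fmeasurable:
  "{x \<in> {0..1}. (farey ^^ k) x \<in> {a..b}} \<in> fmeasurable lborel"
  by (rule fmeasurableI2[of "{0..1}"]) (auto simp: fmeasurable_def)

lemma measure_farey_preimage:
  assumes "0 \<le> a" "a \<le> b" "b \<le> 1"
  shows "measure lborel {x \<in> {0..1}. (farey ^^ k) x \<in> {a..b}} = farey_cdf k b - farey_cdf k a"
  using assms
proof (induction k arbitrary: a b)
  case 0
  then have "{x \<in> {0..1}. x \<in> {a..b}} = {a..b}"
    by auto
  then show ?case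
    using 0 by simp
next
  case (Suc k)
  let ?E = "\<lambda>a b. {x \<in> {0..1}. (farey ^^ k) x \<in> {a..b}}"
  note bounds = \<open>0 \<le> a\<close> \<open>a \<le> b\<close> \<open>b \<le> 1\<close>
  have order: "0 \<le> a / (1 + a)" "a / (1 + a) \<le> b / (1 + b)" "b / (1 + b) \<le> 1 / 2"
    "1 / 2 \<le> 1 / (1 + b)" "1 / (1 + b) \<le> 1 / (1 + a)" "1 / (1 + a) \<le> 1"
    "b / (1 + b) \<le> 1" "0 \<le> 1 / (1 + b)"
    using bounds by (auto simp: field_simps)
  have split: "{x \<in> {0..1}. (farey ^^ Suc k) x \<in> {a..b}}
      = ?E (a / (1 + a)) (b / (1 + b)) \<union> ?E (1 / (1 + b)) (1 / (1 + a))"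
    using farey_vimage_Icc[OF bounds] farey_funpow_in_unit[of _ k] by auto
  \<comment> \<open>The overlap is null: it lies in the \<open>k\<close>-fold preimage of the point
    1/2, which the induction hypothesis on the degenerate interval \<open>{1/2..1/2}\<close> gives
    measure 0.\<close>
  have "?E (a / (1 + a)) (b / (1 + b)) \<inter> ?E (1 / (1 + b)) (1 / (1 + a)) \<subseteq> ?E (1 / 2) (1 / 2)"
  proof -
    have "z = 1 / 2" if "z \<le> b / (1 + b)" "1 / (1 + b) \<le> z" for z
      using order that by linarith
    then show ?thesis
      by auto
  qed
  then have "measure lborel (?E (a / (1 + a)) (b / (1 + b)) \<inter> ?E (1 / (1 + b)) (1 / (1 + a)))
      \<le> measure lborel (?E (1 / 2) (1 / 2))"
    by (intro measure_mono_fmeasurable sets.Int fmeasurableD farey_preimage_fmeasurable)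
  also have "\<dots> = 0"
    using Suc.IH[of "1/2" "1/2"] by simp
  finally have "measure lborel (?E (a / (1 + a)) (b / (1 + b)) \<inter> ?E (1 / (1 + b)) (1 / (1 + a))) = 0"
    by (simp only: measure_le_0_iff)
  then have "measure lborel {x \<in> {0..1}. (farey ^^ Suc k) x \<in> {a..b}}
      = measure lborel (?E (a / (1 + a)) (b / (1 + b))) + measure lborel (?E (1 / (1 + b)) (1 / (1 + a)))"
    unfolding split
    by (simp only: measure_Un3[OF farey_preimage_fmeasurable farey_preimage_fmeasurable] diff_zero)
  also have "\<dots> = farey_cdf (Suc k) b - farey_cdf (Suc k) a"
    using order Suc.IH[of "a / (1 + a)" "b / (1 + b)"] Suc.IH[of "1 / (1 + b)" "1 / (1 + a)"] by simp
  finally show ?case .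
qed

text \<open>Differentiating the recursion of \<open>farey_cdf\<close> and multiplying by
  \<open>x\<close> yields the recursion of \<open>farey_dens\<close>.\<close>

lemma farey_cdf_has_derivative:
  assumes "x > 0"
  shows "(farey_cdf k has_real_derivative farey_dens k x / x) (at x)"
  using assms
proof (induction k arbitrary: x)
  case 0
  have "farey_cdf 0 = (\<lambda>x. x)"
    by auto
  then show ?case
    using 0 by simp
next
  case (Suc k)
  let ?s = "x / (1 + x)" and ?t = "1 / (1 + x)"
  have cdf: "farey_cdf (Suc k) = (\<lambda>y. farey_cdf k (y / (1 + y)) + 1 - farey_cdf k (1 / (1 + y)))"
    by auto
  have ds: "((\<lambda>y. y / (1 + y)) has_real_derivative 1 / (1 + x)\<^sup>2) (at x)"
    using \<open>x > 0\<close> by (auto intro!: derivative_eq_intros simp: field_simps power2_eq_square)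
  have dt: "((\<lambda>y. 1 / (1 + y)) has_real_derivative - (1 / (1 + x)\<^sup>2)) (at x)"
    using \<open>x > 0\<close> by (auto intro!: derivative_eq_intros simp: field_simps power2_eq_square)
  have "((\<lambda>y. farey_cdf k (y / (1 + y))) has_real_derivative
      farey_dens k ?s / ?s * (1 / (1 + x)\<^sup>2)) (at x)"
    by (rule DERIV_chain2[OF Suc.IH ds]) (use \<open>x > 0\<close> in auto)
  moreover have "((\<lambda>y. farey_cdf k (1 / (1 + y))) has_real_derivative
      farey_dens k ?t / ?t * (- (1 / (1 + x)\<^sup>2))) (at x)"
    by (rule DERIV_chain2[OF Suc.IH dt]) (use \<open>x > 0\<close> in auto)
  ultimately have "(farey_cdf (Suc k) has_real_derivative
      farey_dens k ?s / ?s * (1 / (1 + x)\<^sup>2) + 0 - farey_dens k ?t / ?t * (- (1 / (1 + x)\<^sup>2))) (at x)"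
    unfolding cdf by (intro DERIV_add DERIV_diff DERIV_const)
  moreover have "farey_dens k ?s / ?s * (1 / (1 + x)\<^sup>2) + 0 - farey_dens k ?t / ?t * (- (1 / (1 + x)\<^sup>2))
      = farey_dens (Suc k) x / x"
    using \<open>x > 0\<close> by (simp add: divide_simps power2_eq_square)
  ultimately show ?case
    by (simp only:)
qed

section \<open>The cone preserved by the transfer operator\<close>

text \<open>Concavity lets monotonicity survive the transfer operator, which does not preserve
  monotonicity alone.\<close>

definition mono_concave :: "(real \<Rightarrow> real) \<Rightarrow> bool" where
  "mono_concave g \<longleftrightarrow> (\<forall>x\<in>{0<..1}. 0 \<le> g x) \<and> mono_on {0<..1} g \<and> concave_on {0<..1} g"

text \<open>With \<open>t = 1 / (1 + x)\<close> the transfer operator becomes \<open>t g(1 - t) + (1 - t) g(t)\<close>: each product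
  has concave factors of opposite monotonicity, and the sum is symmetric about \<open>t = 1 / 2\<close>.\<close>

lemma transfer_mono_concave:
  assumes "mono_concave g"
  shows "mono_concave (\<lambda>x. (g (x / (1 + x)) + x * g (1 / (1 + x))) / (1 + x))" (is "mono_concave ?h")
proof -
  define K where "K t = t * g (1 - t) + g t * (1 - t)" for t
  have nonneg: "0 \<le> g x" if "0 < x" "x \<le> 1" for x
    using assms that by (auto simp: mono_concave_def)
  have mono: "g x \<le> g y" if "0 < x" "x \<le> y" "y \<le> 1" for x y
    using assms that by (auto simp: mono_concave_def mono_on_def)
  have conc: "u * g x + v * g y \<le> g (u * x + v * y)"
    if "0 < x" "x \<le> 1" "0 < y" "y \<le> 1" "0 \<le> u" "0 \<le> v" "u + v = 1" for u v x y
    using assms that by (auto simp: mono_concave_def concave_on_iff)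
  have h_eq: "?h x = K (1 / (1 + x))" if "0 < x" for x
  proof -
    have "1 - 1 / (1 + x) = x / (1 + x)"
      using that by (simp add: field_simps)
    then show ?thesis
      by (simp add: K_def add_divide_distrib mult.commute)
  qed
  have g_conc: "concave_on {0<..<1} g"
    by (auto simp: concave_on_iff intro!: conc)
  have g_conc': "concave_on {0<..<1} (\<lambda>t. g (1 - t))"
    unfolding concave_on_iff
  proof (intro conjI ballI allI impI)
    fix x y u v :: real
    assume *: "x \<in> {0<..<1}" "y \<in> {0<..<1}" "0 \<le> u" "0 \<le> v" "u + v = 1"
    have "1 - (u * x + v * y) = u * (1 - x) + v * (1 - y)"
      using \<open>u + v = 1\<close> by algebra
    then show "u * g (1 - x) + v * g (1 - y) \<le> g (1 - (u *\<^sub>R x + v *\<^sub>R y))"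
      using * by (simp add: conc)
  qed simp
  have K_conc: "concave_on {0<..<1} K"
    unfolding K_def
  proof (intro concave_on_add concave_on_mul g_conc g_conc')
    show "concave_on {0<..<1} (\<lambda>t::real. t)" "concave_on {0<..<1} (\<lambda>t::real. 1 - t)"
      by (auto simp: concave_on_iff algebra_simps)
    show "antimono_on {0<..<1} (\<lambda>t. g (1 - t))"
      by (intro monotone_onI mono) auto
    show "mono_on {0<..<1} g"
      by (intro monotone_onI mono) auto
  qed (auto intro!: monotone_onI nonneg)
  have K_concD: "u * K x + v * K y \<le> K (u * x + v * y)"
    if "x \<in> {0<..<1}" "y \<in> {0<..<1}" "0 \<le> u" "0 \<le> v" "u + v = 1" for u v x y
    using K_conc that by (auto simp: concave_on_iff)
  have K_antimono: "K b \<le> K a" if "1 / 2 \<le> a" "a \<le> b" "b < 1" for a b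
  proof (cases "b = 1 / 2")
    case True
    then have "a = b"
      using that by linarith
    then show ?thesis
      by simp
  next
    case False
    then have "0 < 2 * b - 1"
      using that by simp
    \<comment> \<open>These weights write \<open>a\<close> as a convex combination of
      \<open>1 - b\<close> and \<open>b\<close>, where \<open>K\<close> takes equal values. For
      \<open>b = 1 / 2\<close> the denominator vanishes.\<close>
    define u v where "u = (b - a) / (2 * b - 1)" and "v = (a + b - 1) / (2 * b - 1)"
    have "0 \<le> u" "0 \<le> v"
      using that \<open>0 < 2 * b - 1\<close> by (auto simp: u_def v_def)
    moreover have "u + v = 1"
      using \<open>0 < 2 * b - 1\<close> by (simp add: u_def v_def flip: add_divide_distrib)
    ultimately have "u * K (1 - b) + v * K b \<le> K (u * (1 - b) + v * b)"
      using that by (intro K_concD) auto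
    moreover have "K (1 - b) = K b"
      by (simp add: K_def)
    moreover have "u * (1 - b) + v * b = a"
    proof -
      have "u * (1 - b) + v * b = ((b - a) * (1 - b) + (a + b - 1) * b) / (2 * b - 1)"
        by (simp add: u_def v_def add_divide_distrib)
      also have "(b - a) * (1 - b) + (a + b - 1) * b = a * (2 * b - 1)"
        by algebra
      finally show ?thesis
        using \<open>0 < 2 * b - 1\<close> by simp
    qed
    ultimately show ?thesis
      using \<open>u + v = 1\<close> by (metis distrib_right mult_1)
  qed
  show ?thesis
    unfolding mono_concave_def
  proof (intro conjI ballI)
    show "0 \<le> ?h x" if "x \<in> {0<..1}" for x
      using that by (auto intro!: divide_nonneg_nonneg add_nonneg_nonneg mult_nonneg_nonneg nonneg)
    show "mono_on {0<..1} ?h"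
    proof (rule monotone_onI)
      fix x y :: real
      assume *: "x \<in> {0<..1}" "y \<in> {0<..1}" "x \<le> y"
      then have "K (1 / (1 + x)) \<le> K (1 / (1 + y))"
        by (intro K_antimono) (auto simp: field_simps)
      then show "?h x \<le> ?h y"
        using h_eq * by simp
    qed
    show "concave_on {0<..1} ?h"
      unfolding concave_on_iff
    proof (intro conjI ballI allI impI)
      fix x y u v :: real
      assume *: "x \<in> {0<..1}" "y \<in> {0<..1}" "0 \<le> u" "0 \<le> v" "u + v = 1"
      define z where "z = u * x + v * y"
      have z: "z \<in> {0<..1}"
        unfolding z_def using * convexD[OF convex_real_interval(6)[of 0 1]] by fastforce
      have t: "1 / (1 + x) \<in> {1/2..<1}" "1 / (1 + y) \<in> {1/2..<1}" "1 / (1 + z) \<in> {1/2..<1}"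
        using * z by (auto simp: field_simps)
      \<comment> \<open>A decreasing concave function of a convex one is concave: \<open>w\<close>
        lies above \<open>1 / (1 + z)\<close> by convexity of the reciprocal, and \<open>K\<close>
        decreases on this range.\<close>
      define w where "w = u * (1 / (1 + x)) + v * (1 / (1 + y))"
      have "w \<in> {1/2..<1}"
        unfolding w_def using t * convexD[OF convex_real_interval(7)[of "1/2" 1]] by fastforce
      have "u * inverse (1 + x) + v * inverse (1 + y) \<ge> inverse (u * (1 + x) + v * (1 + y))"
        using convex_on_inverse[of "{0<..}"] * by (auto simp: convex_on_def)
      moreover have "u * (1 + x) + v * (1 + y) = 1 + z"
        using \<open>u + v = 1\<close> unfolding z_def by algebra
      ultimately have "1 / (1 + z) \<le> w"
        by (simp add: w_def inverse_eq_divide)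
      then have "K w \<le> K (1 / (1 + z))"
        using t \<open>w \<in> {1/2..<1}\<close> by (auto intro: K_antimono)
      moreover have "u * K (1 / (1 + x)) + v * K (1 / (1 + y)) \<le> K w"
        unfolding w_def using t * by (intro K_concD) auto
      moreover have "?h x = K (1 / (1 + x))" "?h y = K (1 / (1 + y))" "?h z = K (1 / (1 + z))"
        using h_eq * z by auto
      ultimately show "u * ?h x + v * ?h y \<le> ?h (u *\<^sub>R x + v *\<^sub>R y)"
        by (simp add: z_def)
    qed simp
  qed
qed

lemma farey_dens_mono_concave: "mono_concave (farey_dens k)"
proof (induction k)
  case 0
  have "farey_dens 0 = (\<lambda>x. x)"
    by auto
  then show ?case
    by (auto simp: mono_concave_def concave_on_ident intro: monotone_onI)
next
  case (Suc k)
  have "farey_dens (Suc k) = (\<lambda>x. (farey_dens k (x / (1 + x)) + x * farey_dens k (1 / (1 + x))) / (1 + x))"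
    by auto
  then show ?case
    using transfer_mono_concave[OF Suc] by simp
qed

lemma farey_dens_nonneg: "0 \<le> farey_dens k x" if "0 < x" "x \<le> 1"
  using that farey_dens_mono_concave[of k] by (auto simp: mono_concave_def)

lemma farey_dens_mono: "farey_dens k x \<le> farey_dens k y" if "0 < x" "x \<le> y" "y \<le> 1"
  using that farey_dens_mono_concave[of k] by (auto simp: mono_concave_def mono_on_def)

text \<open>Both inverse branches send 1 to 1/2. This makes the values at 1 decrease in
  \<open>k\<close>, makes the deficits at 1/2 telescope, and causes the index shift in
  \<open>renewal_upper\<close>.\<close>

lemma farey_dens_half: "farey_dens k (1 / 2) = farey_dens (Suc k) 1"
  by simp

lemma farey_dens_1_Suc_le: "farey_dens (Suc k) 1 \<le> farey_dens k 1"
  unfolding farey_dens_half[symmetric] by (rule farey_dens_mono) auto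

lemma farey_dens_1_antimono: "i \<le> j \<Longrightarrow> farey_dens j 1 \<le> farey_dens i 1"
  by (rule lift_Suc_antimono_le[of "\<lambda>k. farey_dens k 1"]) (use farey_dens_1_Suc_le in auto)

section \<open>From densities at a point to measures of tails\<close>

text \<open>Subtracting \<open>c * ln y\<close> from the distribution function leaves the derivative
  \<open>(farey_dens k y - c) / y\<close>, of constant sign on \<open>{a..1}\<close> if
  \<open>c\<close> is the least or greatest value of the density there.\<close>

lemma farey_cdf_tail_bounds:
  assumes "0 < a" "a \<le> 1"
  shows "farey_dens k a * ln (1 / a) \<le> 1 - farey_cdf k a"
    and "1 - farey_cdf k a \<le> farey_dens k 1 * ln (1 / a)"
proof -
  have deriv: "((\<lambda>y. farey_cdf k y - c * ln y) has_real_derivative (farey_dens k y - c) / y) (at y)"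
    if "a \<le> y" for c y
    using that assms
    by (auto intro!: derivative_eq_intros farey_cdf_has_derivative simp: diff_divide_distrib)
  have "farey_cdf k a - farey_dens k a * ln a \<le> farey_cdf k 1 - farey_dens k a * ln 1"
    using assms
    by (intro DERIV_nonneg_imp_nondecreasing[where f = "\<lambda>y. farey_cdf k y - farey_dens k a * ln y"])
      (auto intro!: exI[of _ "(farey_dens k y - farey_dens k a) / y" for y] deriv divide_nonneg_pos farey_dens_mono)
  then show "farey_dens k a * ln (1 / a) \<le> 1 - farey_cdf k a"
    using assms by (simp add: ln_div)
  have "farey_cdf k a - farey_dens k 1 * ln a \<ge> farey_cdf k 1 - farey_dens k 1 * ln 1"
    using assms
    by (intro DERIV_nonpos_imp_nonincreasing[where f = "\<lambda>y. farey_cdf k y - farey_dens k 1 * ln y"])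
      (auto intro!: exI[of _ "(farey_dens k y - farey_dens k 1) / y" for y] deriv divide_nonpos_pos farey_dens_mono)
  then show "1 - farey_cdf k a \<le> farey_dens k 1 * ln (1 / a)"
    using assms by (simp add: ln_div)
qed

text \<open>The branch \<open>x / (1 + x)\<close> sends \<open>1 / real (Suc m)\<close> to the next
  such point, so induction on \<open>m\<close> starts at 1, where the deficit is 0, and gets below
  any positive number.\<close>

lemma farey_dens_deficit_summable:
  "\<exists>C. \<forall>n. (\<Sum>k<n. farey_dens k 1 - farey_dens k (1 / real (Suc m))) \<le> C"
proof (induction m)
  case 0
  then show ?case
    by auto
next
  case (Suc m)
  then obtain C where C: "(\<Sum>k<n. farey_dens k 1 - farey_dens k (1 / real (Suc m))) \<le> C" for n
    by blast
  define x where "x = 1 / real (Suc m)"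
  let ?D = "\<lambda>k x. farey_dens k 1 - farey_dens k x"
  have x: "0 < x" "x \<le> 1" "1 / real (Suc (Suc m)) = x / (1 + x)"
    by (auto simp: x_def field_simps)
  have D_nonneg: "0 \<le> ?D k y" if "0 < y" "y \<le> 1" for k y
    using that farey_dens_mono[of y 1 k] by simp
  have step: "?D k (x / (1 + x)) \<le> 2 * (farey_dens k 1 - farey_dens (Suc k) 1 + ?D (Suc k) x)" for k
  proof -
    \<comment> \<open>The recursion for \<open>farey_dens (Suc k) x\<close> is solved for its term
      at \<open>x / (1 + x)\<close>; the deficit at \<open>1 / (1 + x)\<close> enters negatively and
      is dropped.\<close>
    have "?D k (x / (1 + x)) = (1 + x) * (farey_dens k 1 - farey_dens (Suc k) x) - x * ?D k (1 / (1 + x))"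
      using x by (simp add: field_simps)
    also have "\<dots> \<le> (1 + x) * (farey_dens k 1 - farey_dens (Suc k) x)"
      using x D_nonneg[of "1 / (1 + x)" k] by simp
    also have "\<dots> \<le> 2 * (farey_dens k 1 - farey_dens (Suc k) x)"
      using x farey_dens_1_Suc_le[of k] D_nonneg[of x "Suc k"]
      by (intro mult_right_mono) linarith+
    finally show ?thesis
      by simp
  qed
  have "(\<Sum>k<n. ?D k (x / (1 + x))) \<le> 2 * (1 + C)" for n
  proof -
    have "(\<Sum>k<n. ?D k (x / (1 + x)))
        \<le> (\<Sum>k<n. 2 * (farey_dens k 1 - farey_dens (Suc k) 1 + ?D (Suc k) x))"
      by (intro sum_mono step)
    also have "\<dots> = 2 * ((\<Sum>k<n. farey_dens k 1 - farey_dens (Suc k) 1) + (\<Sum>k<n. ?D (Suc k) x))"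
      by (simp only: sum.distrib flip: sum_distrib_left)
    also have "(\<Sum>k<n. farey_dens k 1 - farey_dens (Suc k) 1) = farey_dens 0 1 - farey_dens n 1"
      by (rule sum_lessThan_telescope')
    also have "(\<Sum>k<n. ?D (Suc k) x) = (\<Sum>k<Suc n. ?D k x) - ?D 0 x"
      by (simp only: sum.lessThan_Suc_shift)
    \<comment> \<open>The 1 bounds the telescoped difference, as
      \<open>farey_dens 0 1 = 1\<close>.\<close>
    also have "2 * (farey_dens 0 1 - farey_dens n 1 + ((\<Sum>k<Suc n. ?D k x) - ?D 0 x)) \<le> 2 * (1 + C)"
      using C[of "Suc n", folded x_def] D_nonneg[OF x(1,2), of 0] farey_dens_nonneg[of 1 n]
      by simp
    finally show ?thesis .
  qed
  then show ?case
    unfolding x(3) by blast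
qed

section \<open>The renewal identity and its summed inequalities\<close>

text \<open>Orbits are sorted by the last time \<open>k < n\<close> spent on the right branch; the
  first term counts those that never visit it. The later bounds use \<open>m = 0\<close>, where the
  left side is 1.\<close>

lemma farey_cdf_renewal:
  "farey_cdf n (1 / real (Suc m)) = 1 / real (Suc (m + n))
     + (\<Sum>k<n. 1 - farey_cdf k (real (m + n - k) / real (Suc (m + n - k))))"
proof (induction n arbitrary: m)
  case 0
  then show ?case
    by simp
next
  case (Suc n)
  have "farey_cdf (Suc n) (1 / real (Suc m))
      = farey_cdf n (1 / real (Suc (Suc m))) + 1 - farey_cdf n (real (Suc m) / real (Suc (Suc m)))"
    by (simp add: field_simps)
  also have "farey_cdf n (1 / real (Suc (Suc m))) = 1 / real (Suc (Suc m + n))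
      + (\<Sum>k<n. 1 - farey_cdf k (real (Suc m + n - k) / real (Suc (Suc m + n - k))))"
    by (rule Suc)
  finally show ?case
    by simp
qed

text \<open>The identity at time \<open>Suc N\<close>, with the upper tail bound, controls the
  increment of the right side in \<open>N\<close>. The terms \<open>1 / real (Suc (Suc N))\<close>
  add up to at most the subtracted logarithm.\<close>

lemma renewal_lower:
  "real N - ln (real N + 1) \<le> (\<Sum>k<N. farey_dens k 1 * ln (real (Suc N - k)))"
proof (induction N)
  case 0
  then show ?case
    by simp
next
  case (Suc N)
  let ?b = "\<lambda>k. farey_dens k 1"
  have "1 - 1 / real (Suc (Suc N))
      = (\<Sum>k<Suc N. 1 - farey_cdf k (real (Suc N - k) / real (Suc (Suc N - k))))"
    using farey_cdf_renewal[of "Suc N" 0] by simp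
  also have "\<dots> \<le> (\<Sum>k<Suc N. ?b k * (ln (real (Suc (Suc N) - k)) - ln (real (Suc N - k))))"
  proof (rule sum_mono)
    fix k assume "k \<in> {..<Suc N}"
    then have "Suc (Suc N) - k = Suc (Suc N - k)" "0 < Suc N - k"
      by auto
    then show "1 - farey_cdf k (real (Suc N - k) / real (Suc (Suc N - k)))
        \<le> ?b k * (ln (real (Suc (Suc N) - k)) - ln (real (Suc N - k)))"
      using farey_cdf_tail_bounds(2)[of "real (Suc N - k) / real (Suc (Suc N - k))" k]
      by (simp add: ln_div del: of_nat_Suc)
  qed
  \<comment> \<open>The second sum stops at \<open>k < N\<close> because its term
    \<open>k = N\<close> is \<open>ln 1 = 0\<close>.\<close>
  also have "\<dots> = (\<Sum>k<Suc N. ?b k * ln (real (Suc (Suc N) - k))) - (\<Sum>k<N. ?b k * ln (real (Suc N - k)))"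
    by (simp add: right_diff_distrib sum_subtractf)
  finally have "1 - 1 / real (Suc (Suc N)) \<le> \<dots>" .
  moreover have "1 / real (Suc (Suc N)) \<le> ln (real (Suc N) + 1) - ln (real N + 1)"
    using ln_le_minus_one[of "(real N + 1) / (real N + 2)"] by (simp add: ln_div field_simps)
  ultimately show ?case
    using Suc by simp
qed

text \<open>Here the lower tail bound is used at points \<open>a\<close> in \<open>{1/2..1}\<close>,
  where the density is at least its value at 1/2, that is
  \<open>farey_dens (Suc k) 1\<close>.\<close>

lemma renewal_upper:
  "(\<Sum>k<N. farey_dens (Suc k) 1 * ln (real (Suc N - k))) \<le> real N"
proof (induction N)
  case 0
  then show ?case
    by simp
next
  case (Suc N)
  let ?b = "\<lambda>k. farey_dens (Suc k) 1"
  have "(\<Sum>k<Suc N. ?b k * ln (real (Suc (Suc N) - k))) - (\<Sum>k<N. ?b k * ln (real (Suc N - k)))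
      = (\<Sum>k<Suc N. ?b k * (ln (real (Suc (Suc N) - k)) - ln (real (Suc N - k))))"
    by (simp add: right_diff_distrib sum_subtractf del: farey_dens.simps)
  also have "\<dots> \<le> (\<Sum>k<Suc N. 1 - farey_cdf k (real (Suc N - k) / real (Suc (Suc N - k))))"
  proof (rule sum_mono)
    fix k assume "k \<in> {..<Suc N}"
    then have j: "Suc (Suc N) - k = Suc (Suc N - k)" "0 < Suc N - k"
      by auto
    define a where "a = real (Suc N - k) / real (Suc (Suc N - k))"
    have a: "1 / 2 \<le> a" "a \<le> 1"
      using j by (auto simp: a_def field_simps)
    have ln_a: "ln (1 / a) = ln (real (Suc (Suc N) - k)) - ln (real (Suc N - k))"
      using j by (simp add: a_def ln_div del: of_nat_Suc)
    have "0 \<le> ln (1 / a)"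
      using a by simp
    then have "?b k * ln (1 / a) \<le> farey_dens k a * ln (1 / a)"
      unfolding farey_dens_half[symmetric] using a by (intro mult_right_mono farey_dens_mono) auto
    also have "\<dots> \<le> 1 - farey_cdf k a"
      using a by (intro farey_cdf_tail_bounds) auto
    finally show "?b k * (ln (real (Suc (Suc N) - k)) - ln (real (Suc N - k)))
        \<le> 1 - farey_cdf k (real (Suc N - k) / real (Suc (Suc N - k)))"
      unfolding ln_a unfolding a_def .
  qed
  also have "\<dots> = 1 - 1 / real (Suc (Suc N))"
    using farey_cdf_renewal[of "Suc N" 0] by simp
  also have "\<dots> \<le> 1"
    by simp
  finally show ?case
    using Suc by simp
qed

section \<open>Two-sided bounds for the sum of the densities at 1\<close>

text \<open>A weak Stirling bound: the sum is the logarithm of the factorial of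
  \<open>N + 1\<close>.\<close>

lemma sum_ln_ge: "real N * ln (real N) - real N \<le> (\<Sum>k<N. ln (real (Suc N - k)))"
proof (induction N)
  case 0
  then show ?case
    by simp
next
  case (Suc N)
  have "real N * ln (real (Suc N)) \<le> real N * ln (real N) + 1"
  proof (cases "N = 0")
    case False
    then have "ln (real (Suc N)) - ln (real N) \<le> 1 / real N"
      using ln_le_minus_one[of "real (Suc N) / real N"] by (simp add: ln_div field_simps)
    then show ?thesis
      using False by (simp add: field_simps)
  qed simp
  moreover have "ln (real (Suc N)) \<le> ln (real (Suc (Suc N)))"
    by simp
  moreover have "(\<Sum>k<Suc N. ln (real (Suc (Suc N) - k))) = ln (real (Suc (Suc N))) + (\<Sum>k<N. ln (real (Suc N - k)))"
    by (simp only: sum.lessThan_Suc_shift diff_Suc_Suc minus_nat.diff_0)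
  moreover have "real (Suc N) * ln (real (Suc N)) = real N * ln (real (Suc N)) + ln (real (Suc N))"
    by (simp add: distrib_right)
  ultimately show ?case
    using Suc.IH by linarith
qed

lemma sum_farey_dens_lower: "(real n + 1) / ln (real n + 2) - 1 \<le> (\<Sum>k\<le>n. farey_dens k 1)"
proof -
  have "real n + 1 - ln (real n + 2) \<le> (\<Sum>k<Suc n. farey_dens k 1 * ln (real (Suc (Suc n) - k)))"
    using renewal_lower[of "Suc n"] by (simp add: add.commute)
  also have "\<dots> \<le> (\<Sum>k<Suc n. farey_dens k 1 * ln (real n + 2))"
    by (intro sum_mono mult_left_mono farey_dens_nonneg) auto
  also have "\<dots> = (\<Sum>k\<le>n. farey_dens k 1) * ln (real n + 2)"
    by (simp add: sum_distrib_right lessThan_Suc_atMost)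
  finally show ?thesis
    by (simp add: field_simps)
qed

lemma sum_farey_dens_upper:
  assumes "ln (real n) > 1"
  shows "(\<Sum>k\<le>n. farey_dens k 1) \<le> 1 + real n / (ln (real n) - 1)"
proof -
  let ?b = "\<lambda>k. farey_dens (Suc k) 1"
  have "n > 0"
    using assms by (cases n) auto
  have nonneg: "0 \<le> (\<Sum>k<n. ?b k)"
    by (intro sum_nonneg farey_dens_nonneg) auto
  \<comment> \<open>Chebyshev's inequality in this direction needs oppositely ordered sequences; the
    sign turns the decreasing \<open>?b\<close> into an increasing one.\<close>
  have "real n * (\<Sum>k = 0..<n. - ?b k * ln (real (Suc n - k)))
      \<le> (\<Sum>k = 0..<n. - ?b k) * (\<Sum>k = 0..<n. ln (real (Suc n - k)))"
    by (rule Chebyshev_sum_upper) (auto intro: farey_dens_1_antimono simp del: farey_dens.simps)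
  then have "(\<Sum>k<n. ?b k) * (\<Sum>k<n. ln (real (Suc n - k)))
      \<le> real n * (\<Sum>k<n. ?b k * ln (real (Suc n - k)))"
    by (simp add: sum_negf lessThan_atLeast0 del: farey_dens.simps)
  also have "\<dots> \<le> real n * real n"
    by (intro mult_left_mono renewal_upper) auto
  finally have "(\<Sum>k<n. ?b k) * (\<Sum>k<n. ln (real (Suc n - k))) \<le> real n * real n" .
  moreover have "(\<Sum>k<n. ?b k) * (real n * (ln (real n) - 1)) \<le> (\<Sum>k<n. ?b k) * (\<Sum>k<n. ln (real (Suc n - k)))"
    using sum_ln_ge[of n] nonneg by (intro mult_left_mono) (auto simp: algebra_simps)
  ultimately have "real n * ((\<Sum>k<n. ?b k) * (ln (real n) - 1)) \<le> real n * real n"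
    by (simp add: mult_ac del: farey_dens.simps)
  then have "(\<Sum>k<n. ?b k) * (ln (real n) - 1) \<le> real n"
    using \<open>n > 0\<close> by (simp del: farey_dens.simps)
  then have "(\<Sum>k<n. ?b k) \<le> real n / (ln (real n) - 1)"
    using assms by (simp add: field_simps del: farey_dens.simps)
  moreover have "(\<Sum>k\<le>n. farey_dens k 1) = 1 + (\<Sum>k<n. ?b k)"
    by (subst sum.atMost_shift) (simp add: lessThan_atLeast0)
  ultimately show ?thesis
    by simp
qed

section \<open>The asymptotic formula\<close>

theorem theorem2:
  fixes u :: real
  assumes "0 < u" and "u < 1"
  shows "(\<lambda>n::nat. (\<Sum>k=0..n. measure lborel (farey_C u (k + 1)))
            - real n * ln (1 / u) / ln (real n))
         \<in> O(\<lambda>n::nat. (real n * ln (1 / u) / ln (real n)) * (1 / ln (real n)))"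
proof -
  define L where "L = ln (1 / u)"
  have "L > 0"
    using assms by (simp add: L_def)
  \<comment> \<open>By monotonicity of the densities, the deficit bound at this point below
    \<open>u\<close> also holds at \<open>u\<close>.\<close>
  obtain m where m: "1 / real (Suc m) < u"
    using reals_Archimedean[OF \<open>0 < u\<close>] by (auto simp: inverse_eq_divide)
  obtain C where C: "(\<Sum>k<n. farey_dens k 1 - farey_dens k (1 / real (Suc m))) \<le> C" for n
    using farey_dens_deficit_summable by blast
  define S where "S n = (\<Sum>k=0..n. measure lborel (farey_C u (k + 1)))" for n
  define B where "B n = (\<Sum>k\<le>n. farey_dens k 1)" for n
  have S_eq: "S n = (\<Sum>k\<le>n. 1 - farey_cdf k u)" for n
    using assms measure_farey_preimage[of u 1] by (simp add: S_def farey_C_def atLeast0AtMost)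
  have S_le: "S n \<le> L * B n" for n
    unfolding S_eq B_def sum_distrib_left L_def
    using assms farey_cdf_tail_bounds(2)[of u] by (intro sum_mono) (simp add: mult.commute)
  have S_ge: "L * (B n - C) \<le> S n" for n
  proof -
    have "B n - C \<le> (\<Sum>k\<le>n. farey_dens k (1 / real (Suc m)))"
      using C[of "Suc n"] by (simp add: B_def sum_subtractf lessThan_Suc_atMost)
    also have "\<dots> \<le> (\<Sum>k\<le>n. farey_dens k u)"
      using m assms by (intro sum_mono farey_dens_mono) auto
    finally have "L * (B n - C) \<le> (\<Sum>k\<le>n. L * farey_dens k u)"
      using \<open>L > 0\<close> by (simp flip: sum_distrib_left)
    also have "\<dots> \<le> S n"
      unfolding S_eq L_def
      using assms farey_cdf_tail_bounds(1)[of u] by (intro sum_mono) (simp add: mult.commute)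
    finally show ?thesis .
  qed
  \<comment> \<open>Both errors are relative to \<open>real n / ln (real n)\<close>; in
    \<open>?lo\<close>, the constant joins the 1 lost in \<open>sum_farey_dens_lower\<close> and the
    total deficit \<open>C\<close>.\<close>
  let ?lo = "\<lambda>n. real n / ln (real n) - (real n + 1) / ln (real n + 2) + (1 + C)"
  let ?hi = "\<lambda>n. real n / (ln (real n) - 1) - real n / ln (real n) + 1"
  let ?e = "\<lambda>n. real n / ln (real n) * (1 / ln (real n))"
  have "(\<lambda>n. real n / ln (real n) - (real n + 1) / ln (real n + 2)) \<in> O(?e)" "(\<lambda>n. 1 + C) \<in> O(?e)"
    by real_asymp+
  then have lo: "?lo \<in> O(?e)"
    by (rule sum_in_bigo)
  have hi: "?hi \<in> O(?e)"
    by real_asymp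
  have "eventually (\<lambda>n. ln (real n) > 1) at_top"
    by real_asymp
  then have "eventually (\<lambda>n. norm (S n - real n * L / ln (real n)) \<le> norm (L * (\<bar>?lo n\<bar> + \<bar>?hi n\<bar>))) at_top"
  proof eventually_elim
    case (elim n)
    have "B n - real n / ln (real n) \<le> ?hi n"
      using sum_farey_dens_upper[OF elim] by (simp add: B_def)
    then have "L * (B n - real n / ln (real n)) \<le> L * ?hi n"
      using \<open>L > 0\<close> by (intro mult_left_mono) auto
    then have 1: "S n - real n * L / ln (real n) \<le> L * ?hi n"
      using S_le[of n] by (simp add: algebra_simps)
    have "real n / ln (real n) - (B n - C) \<le> ?lo n"
      using sum_farey_dens_lower[of n] by (simp add: B_def)
    then have "L * (real n / ln (real n) - (B n - C)) \<le> L * ?lo n"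
      using \<open>L > 0\<close> by (intro mult_left_mono) auto
    then have 2: "real n * L / ln (real n) - S n \<le> L * ?lo n"
      using S_ge[of n] by (simp add: algebra_simps)
    have "L * ?hi n \<le> L * (\<bar>?lo n\<bar> + \<bar>?hi n\<bar>)" "L * ?lo n \<le> L * (\<bar>?lo n\<bar> + \<bar>?hi n\<bar>)"
      using \<open>L > 0\<close> by (intro mult_left_mono; linarith)+
    with 1 2 show ?case
      unfolding real_norm_def by linarith
  qed
  then have "(\<lambda>n. S n - real n * L / ln (real n)) \<in> O(\<lambda>n. L * (\<bar>?lo n\<bar> + \<bar>?hi n\<bar>))"
    by (rule landau_o.big_mono)
  also have "(\<lambda>n. L * (\<bar>?lo n\<bar> + \<bar>?hi n\<bar>)) \<in> O(\<lambda>n. L * ?e n)"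
    using lo hi by (intro landau_o.big.mult sum_in_bigo) auto
  also have "(\<lambda>n. L * ?e n) = (\<lambda>n. real n * L / ln (real n) * (1 / ln (real n)))"
    by (simp add: algebra_simps)
  finally show ?thesis
    by (simp add: S_def L_def)
qed

end
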